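(* Let $n,d\ge 1$ and let $(X_1,\ldots,X_d)\in M_n(\mathbb{C})^d$. Then $$\hat{\rho}(X_1,\ldots,X_d)=\lim_{k\to\infty}\ \sup_{\sum|a_{i_1,\ldots,i_k}|^2=1}\ \left\|\sum_{1\le i_1,\ldots,i_k\le d}a_{i_1,\ldots,i_k}X_{i_1}\cdots X_{i_k}\right\|^{1/k},$$ where for each $k$ the supremum is over all families of complex numbers $(a_{i_1,\ldots,i_k})_{1\le i_1,\ldots,i_k\le d}$ with $\sum_{1\le i_1,\ldots,i_k\le d}|a_{i_1,\ldots,i_k}|^2=1$.
   Context: For a square complex matrix $A$, $\rho(A)$ denotes the spectral radius (maximum modulus of the eigenvalues). $\overline{A}$ is the entrywise complex conjugate and $A\otimes B$ is the Kronecker product. The outer spectral radius of $(X_1,\ldots,X_d)\in M_n(\mathbb{C})^d$ is $$\hat{\rho}(X_1,\ldots,X_d)=\sqrt{\rho\Big(\sum_{i=1}^d\overline{X_i}\otimes X_i\Big)}.$$ $\|\cdot\|$ denotes the operator norm on $M_n(\mathbb{C})$. *)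

theory Defs
  imports
    "Jordan_Normal_Form.Spectral_Radius"
    "HOL-Analysis.L2_Norm"
begin

definition kronecker :: "'a :: times mat \<Rightarrow> 'a mat \<Rightarrow> 'a mat" where
  "kronecker A B =
     mat (dim_row A * dim_row B) (dim_col A * dim_col B)
       (\<lambda>(i, j). A $$ (i div dim_row B, j div dim_col B) * B $$ (i mod dim_row B, j mod dim_col B))"

text \<open>Type \<open>mat\<close> carries no additive monoid class (the zero depends on the dimension), so
  sums of square matrices are taken in the ring of matrices of the given size; all summands are
  meant to lie in its carrier.\<close>

definition finsum_mat :: "nat \<Rightarrow> ('i \<Rightarrow> complex mat) \<Rightarrow> 'i set \<Rightarrow> complex mat" where
  "finsum_mat n f I = finsum (ring_mat TYPE(complex) n ()) f I"

lemma finsum_mat_entrywise: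
  assumes "finite I" and "\<And>i. i \<in> I \<Longrightarrow> f i \<in> carrier_mat n n"
  shows "finsum_mat n f I = mat n n (\<lambda>p. \<Sum>i\<in>I. f i $$ p)"
proof -
  interpret R: ring "ring_mat TYPE(complex) n ()"
    by (rule ring_mat)
  show ?thesis
    using assms
  proof (induction I rule: finite_induct)
    case empty
    show ?case
      by (auto simp: finsum_mat_def ring_mat_simps intro!: eq_matI)
  next
    case (insert i I)
    have "finsum_mat n f (insert i I) = f i + finsum_mat n f I"
      unfolding finsum_mat_def
      by (subst R.finsum_insert) (use insert in \<open>auto simp: ring_mat_simps\<close>)
    then show ?case
      using insert by (auto intro!: eq_matI)
  qed
qed

definition vec_norm2 :: "complex vec \<Rightarrow> real" where
  "vec_norm2 v = L2_set (\<lambda>i. cmod (v $ i)) {..<dim_vec v}"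

text \<open>Operator norm induced by the Euclidean norm (a genuine supremum for at least one column).\<close>

definition op_norm :: "complex mat \<Rightarrow> real" where
  "op_norm A = (SUP v \<in> {v \<in> carrier_vec (dim_col A). vec_norm2 v = 1}. vec_norm2 (A *\<^sub>v v))"

definition outer_spectral_radius :: "nat \<Rightarrow> nat \<Rightarrow> (nat \<Rightarrow> complex mat) \<Rightarrow> real" where
  "outer_spectral_radius n d X =
     sqrt (spectral_radius (finsum_mat (n * n) (\<lambda>i. kronecker (map_mat cnj (X i)) (X i)) {1..d}))"

text \<open>Multi-indices $(i_1, \ldots, i_k)$ with entries in $1, \ldots, d$, as lists.\<close>

definition multi_indices :: "nat \<Rightarrow> nat \<Rightarrow> nat list set" where
  "multi_indices d k = {is. set is \<subseteq> {1..d} \<and> length is = k}"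

definition word_prod :: "nat \<Rightarrow> (nat \<Rightarrow> complex mat) \<Rightarrow> nat list \<Rightarrow> complex mat" where
  "word_prod n X is = foldr (\<lambda>i M. X i * M) is (1\<^sub>m n)"

text \<open>Only the values on \<^term>\<open>multi_indices d k\<close> matter: a total function stands for the
  family of its restrictions there.\<close>

definition unit_families :: "nat \<Rightarrow> nat \<Rightarrow> (nat list \<Rightarrow> complex) set" where
  "unit_families d k = {a. (\<Sum>is\<in>multi_indices d k. (cmod (a is))\<^sup>2) = 1}"

end

theory Submission
  imports Defs
begin

text \<open>Put \<open>T = \<Sum>i. cnj X\<^sub>i \<otimes> X\<^sub>i\<close>, so that \<open>T\<^sup>k\<close> is the sum of \<open>cnj X\<^sub>w \<otimes> X\<^sub>w\<close> over
  the words \<open>w\<close> of length \<open>k\<close>. Its entry at \<open>((i, i), (j, j))\<close> is the energy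
  \<open>\<Sum>w. |(X\<^sub>w)\<^sub>i\<^sub>j|\<^sup>2\<close>, and by Cauchy--Schwarz these entries bound all others. By the equality case
  of Cauchy--Schwarz, the square of the supremum of \<open>\<parallel>\<Sum>w. a\<^sub>w X\<^sub>w\<parallel>\<close> lies between the largest of
  these energies and their sum, so it agrees with the largest entry of \<open>T\<^sup>k\<close> up to the factor
  \<open>n\<^sup>2\<close>. Gelfand's formula for \<open>T\<close> gives the limit.\<close>

section \<open>Squeezing a sequence between k-th roots of geometric sequences\<close>

text \<open>For fixed \<open>c > 0\<close> the factor \<open>root k c\<close> tends to 1, so
  multiplicative constants vanish in the limit. The upper constant may depend on \<open>r\<close>,
  since powers of a matrix with nontrivial Jordan blocks may outgrow every multiple of
  \<open>\<rho> ^ k\<close>.\<close>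

lemma root_squeeze_tendsto:
  fixes f :: "nat \<Rightarrow> real"
  assumes \<rho>: "0 \<le> \<rho>" and C: "0 < C"
    and lower: "\<And>k. k \<ge> 1 \<Longrightarrow> root k (C * \<rho> ^ k) \<le> f k"
    and upper: "\<And>r. r > \<rho> \<Longrightarrow> \<exists>c>0. \<forall>k\<ge>1. f k \<le> root k (c * r ^ k)"
  shows "f \<longlonglongrightarrow> \<rho>"
proof -
  have lim: "(\<lambda>k. root k c * r) \<longlonglongrightarrow> r" if "c > 0" for c r :: real
    using tendsto_mult[OF LIMSEQ_root_const[OF that] tendsto_const, of r] by simp
  have eq: "root k (c * r ^ k) = root k c * r" if "k \<ge> 1" "r \<ge> 0" for k and c r :: real
    using that by (simp add: real_root_mult real_root_power_cancel)
  show ?thesis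
  proof (rule order_tendstoI)
    fix a assume "a < \<rho>"
    then have "\<forall>\<^sub>F k in sequentially. a < root k C * \<rho>"
      by (rule order_tendstoD(1)[OF lim[OF C]])
    then show "\<forall>\<^sub>F k in sequentially. a < f k"
      using eventually_ge_at_top[of 1]
      by eventually_elim (use lower eq[OF _ \<rho>] in fastforce)
  next
    fix a assume "\<rho> < a"
    \<comment> \<open>The gap between \<open>r\<close> and \<open>a\<close> absorbs the constant:
      \<open>root k c * r\<close> tends to \<open>r\<close>, hence is eventually below
      \<open>a\<close>.\<close>
    then obtain r where r: "\<rho> < r" "r < a"
      using dense by blast
    then obtain c where c: "c > 0" "\<forall>k\<ge>1. f k \<le> root k (c * r ^ k)"
      using upper by blast
    have "\<forall>\<^sub>F k in sequentially. root k c * r < a"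
      by (rule order_tendstoD(2)[OF lim[OF c(1)] r(2)])
    then show "\<forall>\<^sub>F k in sequentially. f k < a"
      using eventually_ge_at_top[of 1]
    proof eventually_elim
      case (elim k)
      then show ?case
        using c(2)[rule_format, of k] eq[of k r c] r(1) \<rho> by auto
    qed
  qed
qed

section \<open>Spectral radius and growth of matrix powers\<close>

lemma smult_pow_mat:
  fixes A :: "'a :: comm_semiring_1 mat"
  assumes "A \<in> carrier_mat n n"
  shows "(c \<cdot>\<^sub>m A) ^\<^sub>m k = c ^ k \<cdot>\<^sub>m A ^\<^sub>m k"
proof (induction k)
  case 0
  show ?case by (auto intro!: eq_matI)
next
  case (Suc k)
  have "c ^ k \<cdot>\<^sub>m A ^\<^sub>m k * (c \<cdot>\<^sub>m A) = c \<cdot>\<^sub>m (c ^ k \<cdot>\<^sub>m A ^\<^sub>m k * A)"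
    using assms by (intro mult_smult_distrib[of _ n n _ n]) auto
  also have "c ^ k \<cdot>\<^sub>m A ^\<^sub>m k * A = c ^ k \<cdot>\<^sub>m (A ^\<^sub>m k * A)"
    using assms by (intro mult_smult_assoc_mat[of _ n n _ n]) auto
  finally show ?case
    using Suc by (auto intro!: eq_matI simp: mult.assoc)
qed

lemma spectral_radius_nonneg:
  assumes "A \<in> carrier_mat n n" "n > 0"
  shows "0 \<le> spectral_radius A"
  using spectral_radius_mem_max(1)[OF assms] by auto

text \<open>If \<open>v\<close> is an eigenvector of the scaled matrix for \<open>e\<close>, it is
  one of \<open>A\<close> for \<open>r * e\<close>, so \<open>r * cmod e\<close> is at most the
  spectral radius of \<open>A\<close>.\<close>

lemma spectral_radius_smult_less_1:
  assumes A: "A \<in> carrier_mat n n" and n: "n > 0" and r: "spectral_radius A < r"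
  shows "spectral_radius (complex_of_real (1 / r) \<cdot>\<^sub>m A) < 1"
proof -
  let ?B = "complex_of_real (1 / r) \<cdot>\<^sub>m A"
  have B: "?B \<in> carrier_mat n n"
    using A by simp
  have r0: "r > 0"
    using spectral_radius_nonneg[OF A n] r by simp
  obtain e where e: "e \<in> spectrum ?B" "spectral_radius ?B = cmod e"
    using spectral_radius_mem_max(1)[OF B n] by auto
  then obtain v where v: "v \<in> carrier_vec n" "v \<noteq> 0\<^sub>v n" "?B *\<^sub>v v = e \<cdot>\<^sub>v v"
    using B unfolding spectrum_def eigenvalue_def eigenvector_def by auto
  have "A *\<^sub>v v = (of_real r * e) \<cdot>\<^sub>v v"
  proof (rule eq_vecI)
    fix i assume "i < dim_vec ((of_real r * e) \<cdot>\<^sub>v v)"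
    then have i: "i < n"
      using v by auto
    then have "complex_of_real (1 / r) * (row A i \<bullet> v) = e * v $ i"
      using arg_cong[OF v(3), of "\<lambda>x. x $ i"] A v(1)
      by (simp del: of_real_divide)
    then show "(A *\<^sub>v v) $ i = ((of_real r * e) \<cdot>\<^sub>v v) $ i"
      using i A v(1) r0 by (simp add: field_simps)
  qed (use A v in auto)
  then have "of_real r * e \<in> spectrum A"
    using A v unfolding spectrum_def eigenvalue_def eigenvector_def by auto
  then have "cmod (of_real r * e) \<le> spectral_radius A"
    by (intro spectral_radius_mem_max(2)[OF A n]) auto
  then have "r * cmod e \<le> spectral_radius A"
    using r0 by (simp add: norm_mult)
  then have "r * cmod e < r * 1"
    using r by linarith
  then show ?thesis
    using e(2) r0 by (simp only: mult_less_cancel_left_pos)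
qed

text \<open>The upper half of Gelfand's formula: scaled by \<open>1 / r\<close>, the matrix has
  spectral radius below 1, and the Jordan normal form bounds all its powers uniformly. Undoing the
  scaling gives the factor \<open>r ^ k\<close>.\<close>

lemma spectral_radius_pow_mat_bound:
  assumes A: "A \<in> carrier_mat n n" and n: "n > 0" and r: "spectral_radius A < r"
  shows "\<exists>c>0. \<forall>k. norm_bound (A ^\<^sub>m k) (c * r ^ k)"
proof -
  let ?B = "complex_of_real (1 / r) \<cdot>\<^sub>m A"
  have r0: "r > 0"
    using spectral_radius_nonneg[OF A n] r by simp
  obtain c where c: "\<And>k. norm_bound (?B ^\<^sub>m k) c"
    using spectral_radius_jnf_norm_bound_less_1_upper_triangular[of ?B n]
      spectral_radius_smult_less_1[OF A n r] A by auto
  \<comment> \<open>Replacing \<open>c\<close> by \<open>\<bar>c\<bar> + 1\<close> makes the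
    constant strictly positive, as the limit of its k-th roots requires.\<close>
  have "norm_bound (A ^\<^sub>m k) ((\<bar>c\<bar> + 1) * r ^ k)" for k
  proof
    fix i j assume ij: "i < dim_row (A ^\<^sub>m k)" "j < dim_col (A ^\<^sub>m k)"
    then have "norm ((?B ^\<^sub>m k) $$ (i, j)) = norm ((A ^\<^sub>m k) $$ (i, j)) / r ^ k"
      using r0 by (simp add: smult_pow_mat[OF A] norm_mult norm_power norm_divide power_divide)
    moreover have "norm ((?B ^\<^sub>m k) $$ (i, j)) \<le> c"
      using c[of k] ij A unfolding norm_bound_def smult_pow_mat[OF A] by simp
    ultimately have "norm ((A ^\<^sub>m k) $$ (i, j)) \<le> c * r ^ k"
      using r0 by (simp add: divide_le_eq)
    also have "\<dots> \<le> (\<bar>c\<bar> + 1) * r ^ k"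
      using r0 by (intro mult_right_mono) auto
    finally show "norm ((A ^\<^sub>m k) $$ (i, j)) \<le> (\<bar>c\<bar> + 1) * r ^ k" .
  qed
  then show ?thesis
    by (intro exI[of _ "\<bar>c\<bar> + 1"]) auto
qed

lemma ex_max_on_finite:
  fixes f :: "'a \<Rightarrow> 'b :: linorder"
  assumes "finite S" "S \<noteq> {}"
  obtains x where "x \<in> S" "\<And>y. y \<in> S \<Longrightarrow> f y \<le> f x"
proof -
  have "Max (f ` S) \<in> f ` S"
    using assms by (intro Max_in) auto
  then obtain x where "x \<in> S" "f x = Max (f ` S)"
    by auto
  with that assms show ?thesis
    by (metis Max_ge finite_imageI imageI)
qed

lemma norm_bound_pow_matD:
  assumes A: "A \<in> carrier_mat n n" and b: "norm_bound (A ^\<^sub>m k) b" and ij: "i < n" "j < n"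
  shows "norm ((A ^\<^sub>m k) $$ (i, j)) \<le> b"
  using b ij carrier_matD[OF pow_carrier_mat[OF A, of k]] unfolding norm_bound_def by metis

text \<open>The lower half of Gelfand's formula. For an eigenvector \<open>v\<close> of an
  eigenvalue \<open>e\<close> of maximal modulus, read
  \<open>A ^\<^sub>m k *\<^sub>v v = e ^ k \<cdot>\<^sub>v v\<close> at a coordinate where
  \<open>v\<close> is largest: row \<open>i\<close> contributes \<open>n\<close> terms of size at
  most \<open>b * cmod (v $ i)\<close>, and the nonzero \<open>v $ i\<close> cancels.\<close>

lemma spectral_radius_power_le:
  assumes A: "A \<in> carrier_mat n n" and n: "n > 0" and b: "norm_bound (A ^\<^sub>m k) b"
  shows "spectral_radius A ^ k \<le> real n * b"
proof -
  obtain e where e: "e \<in> spectrum A" "spectral_radius A = cmod e"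
    using spectral_radius_mem_max(1)[OF A n] by auto
  then obtain v where ev: "eigenvector A v e"
    unfolding spectrum_def eigenvalue_def by auto
  then have v: "v \<in> carrier_vec n" "v \<noteq> 0\<^sub>v n"
    using A unfolding eigenvector_def by auto
  obtain i where i: "i < n" "\<And>j. j < n \<Longrightarrow> cmod (v $ j) \<le> cmod (v $ i)"
    using ex_max_on_finite[of "{..<n}" "\<lambda>j. cmod (v $ j)"] n by auto
  have "v $ i \<noteq> 0"
  proof
    assume "v $ i = 0"
    then have "v $ j = 0" if "j < n" for j
      using i(2)[OF that] by simp
    then show False
      using v by (auto intro!: eq_vecI)
  qed
  have "e ^ k * v $ i = (A ^\<^sub>m k *\<^sub>v v) $ i"
    using eigenvector_pow[OF A ev, of k] v(1) i(1) by simp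
  also have "\<dots> = (\<Sum>j<n. (A ^\<^sub>m k) $$ (i, j) * v $ j)"
    using v(1) i(1) carrier_matD[OF pow_carrier_mat[OF A, of k]]
    by (auto simp: scalar_prod_def lessThan_atLeast0 intro!: sum.cong)
  finally have "cmod (e ^ k * v $ i) \<le> (\<Sum>j<n. cmod ((A ^\<^sub>m k) $$ (i, j) * v $ j))"
    by (simp add: norm_sum)
  also have "\<dots> \<le> (\<Sum>j<n. b * cmod (v $ i))"
    unfolding norm_mult
    using norm_bound_pow_matD[OF A b i(1)] i
    by (intro sum_mono mult_mono) (auto intro: order_trans[OF norm_ge_zero])
  finally have "cmod e ^ k * cmod (v $ i) \<le> (real n * b) * cmod (v $ i)"
    by (simp add: norm_mult norm_power)
  then show ?thesis
    using \<open>v $ i \<noteq> 0\<close> e(2) by simp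
qed

section \<open>Kronecker products and index pairs\<close>

lemma kronecker_carrier [intro]:
  "A \<in> carrier_mat m n \<Longrightarrow> B \<in> carrier_mat p q \<Longrightarrow> kronecker A B \<in> carrier_mat (m * p) (n * q)"
  unfolding kronecker_def by auto

lemma index_kronecker:
  assumes "A \<in> carrier_mat m n" "B \<in> carrier_mat p q" "i < m * p" "j < n * q"
  shows "kronecker A B $$ (i, j) = A $$ (i div p, j div q) * B $$ (i mod p, j mod q)"
  using assms unfolding kronecker_def by auto

lemma mult_add_less_mult:
  fixes a b m p :: nat
  assumes "a < m" "b < p"
  shows "a * p + b < m * p"
proof -
  have "a * p + b < Suc a * p"
    using assms by simp
  also have "\<dots> \<le> m * p"
    using assms by (intro mult_right_mono) auto
  finally show ?thesis .
qed

lemma div_mod_less: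
  fixes l m p :: nat
  assumes "l < m * p"
  shows "l div p < m" "l mod p < p"
  using assms by (auto simp: less_mult_imp_div_less intro!: mod_less_divisor Nat.gr0I)

text \<open>An index \<open>l\<close> of a Kronecker product encodes the pair \<open>(a, b)\<close>
  with \<open>l = a * p + b\<close>; quotient and remainder by \<open>p\<close> decode it.\<close>

lemma sum_div_mod:
  fixes f :: "nat \<Rightarrow> nat \<Rightarrow> 'a :: comm_monoid_add"
  shows "(\<Sum>l<m * p. f (l div p) (l mod p)) = (\<Sum>a<m. \<Sum>b<p. f a b)"
  unfolding sum.cartesian_product
proof (rule sum.reindex_bij_witness[of _ "\<lambda>(a, b). a * p + b" "\<lambda>l. (l div p, l mod p)"])
qed (auto simp: div_mod_less mult_add_less_mult)

text \<open>The mixed-product rule. Splitting the summation index into quotient and remainder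
  separates the sum into a product of two independent sums.\<close>

lemma kronecker_mult:
  fixes A B C D :: "'a :: comm_semiring_1 mat"
  assumes A: "A \<in> carrier_mat m n" and B: "B \<in> carrier_mat p q"
    and C: "C \<in> carrier_mat n r" and D: "D \<in> carrier_mat q s"
  shows "kronecker A B * kronecker C D = kronecker (A * C) (B * D)"
proof (rule eq_matI)
  have K: "kronecker A B \<in> carrier_mat (m * p) (n * q)"
    "kronecker C D \<in> carrier_mat (n * q) (r * s)"
    "A * C \<in> carrier_mat m r" "B * D \<in> carrier_mat p s"
    "kronecker (A * C) (B * D) \<in> carrier_mat (m * p) (r * s)"
    using assms by auto
  fix i j assume "i < dim_row (kronecker (A * C) (B * D))" "j < dim_col (kronecker (A * C) (B * D))"
  then have ij: "i < m * p" "j < r * s"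
    using K by auto
  then have dm: "i div p < m" "i mod p < p" "j div s < r" "j mod s < s"
    by (auto simp: div_mod_less)
  have "(kronecker A B * kronecker C D) $$ (i, j) =
      (\<Sum>l<n * q. kronecker A B $$ (i, l) * kronecker C D $$ (l, j))"
    using K(1,2) ij by (auto simp: scalar_prod_def lessThan_atLeast0 intro!: sum.cong)
  also have "\<dots> = (\<Sum>l<n * q. (A $$ (i div p, l div q) * C $$ (l div q, j div s)) *
      (B $$ (i mod p, l mod q) * D $$ (l mod q, j mod s)))"
    using ij by (intro sum.cong) (auto simp: index_kronecker[OF A B] index_kronecker[OF C D] ac_simps)
  also have "\<dots> = (\<Sum>a<n. A $$ (i div p, a) * C $$ (a, j div s)) *
      (\<Sum>b<q. B $$ (i mod p, b) * D $$ (b, j mod s))"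
    by (subst sum_div_mod[where f = "\<lambda>a b. (A $$ (i div p, a) * C $$ (a, j div s)) *
      (B $$ (i mod p, b) * D $$ (b, j mod s))"]) (simp add: sum_product)
  also have "\<dots> = (A * C) $$ (i div p, j div s) * (B * D) $$ (i mod p, j mod s)"
    using assms dm by (auto simp: scalar_prod_def lessThan_atLeast0 intro!: arg_cong2[of _ _ _ _ "(*)"] sum.cong)
  also have "\<dots> = kronecker (A * C) (B * D) $$ (i, j)"
    using index_kronecker[OF K(3,4) ij] by simp
  finally show "(kronecker A B * kronecker C D) $$ (i, j) = kronecker (A * C) (B * D) $$ (i, j)" .
qed (use assms in \<open>auto simp: kronecker_def\<close>)

section \<open>Words and the expansion of powers into words\<close>

lemma finite_multi_indices [simp]: "finite (multi_indices d k)"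
  unfolding multi_indices_def by (rule finite_lists_length_eq) simp

lemma word_prod_carrier:
  assumes X: "X ` I \<subseteq> carrier_mat n n" and w: "set w \<subseteq> I"
  shows "word_prod n X w \<in> carrier_mat n n"
  using w
proof (induction w)
  case (Cons i w)
  then have "X i \<in> carrier_mat n n"
    using X by auto
  with Cons show ?case
    by (auto simp: word_prod_def intro: mult_carrier_mat)
qed (simp add: word_prod_def)

text \<open>\<open>word_prod\<close> unfolds at the first letter, whereas \<open>^\<^sub>m\<close>
  appends its new factor on the right; this moves the recursion to the last letter.\<close>

lemma word_prod_snoc:
  assumes X: "X ` I \<subseteq> carrier_mat n n" and w: "set w \<subseteq> I" and i: "i \<in> I"
  shows "word_prod n X (w @ [i]) = word_prod n X w * X i"
proof -
  have Xi: "X i \<in> carrier_mat n n"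
    using X i by auto
  show ?thesis
    using w
  proof (induction w)
    case Nil
    show ?case
      using Xi by (simp add: word_prod_def)
  next
    case (Cons j w)
    have "X j \<in> carrier_mat n n" "word_prod n X w \<in> carrier_mat n n"
      using Cons.prems X word_prod_carrier[OF X, of w] by auto
    then show ?case
      using Cons Xi by (simp add: word_prod_def assoc_mult_mat[of _ n n _ n _ n])
  qed
qed

lemma sum_multi_indices_Suc:
  fixes f :: "nat list \<Rightarrow> 'a :: comm_monoid_add"
  shows "(\<Sum>w\<in>multi_indices d (Suc k). f w) = (\<Sum>w\<in>multi_indices d k. \<Sum>i\<in>{1..d}. f (w @ [i]))"
  unfolding sum.cartesian_product
proof (rule sum.reindex_bij_witness[of _ "\<lambda>(w, i). w @ [i]" "\<lambda>w. (butlast w, last w)"])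
  fix w assume "w \<in> multi_indices d (Suc k)"
  then show "(case (butlast w, last w) of (w, i) \<Rightarrow> w @ [i]) = w"
    "(butlast w, last w) \<in> multi_indices d k \<times> {1..d}"
    "(case (butlast w, last w) of (w, i) \<Rightarrow> f (w @ [i])) = f w"
    by (cases w rule: rev_cases; auto simp: multi_indices_def)+
qed (auto simp: multi_indices_def)

text \<open>The map \<open>K\<close> below is multiplicative by the mixed-product rule, so expanding
  the k-th power of the sum produces \<open>K\<close> of every word of length \<open>k\<close>
  exactly once.\<close>

lemma kronecker_sum_pow_mat:
  assumes X: "X ` {1..d} \<subseteq> carrier_mat n n" and pq: "p < n * n" "q < n * n"
  shows "(finsum_mat (n * n) (\<lambda>i. kronecker (map_mat cnj (X i)) (X i)) {1..d} ^\<^sub>m k) $$ (p, q) =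
    (\<Sum>w\<in>multi_indices d k. cnj (word_prod n X w $$ (p div n, q div n)) * word_prod n X w $$ (p mod n, q mod n))"
proof -
  define K where "K Y = kronecker (map_mat cnj Y) Y" for Y
  have K: "K Y \<in> carrier_mat (n * n) (n * n)" if "Y \<in> carrier_mat n n" for Y
    using that unfolding K_def by auto
  have K_mult: "K (Y * Z) = K Y * K Z" if "Y \<in> carrier_mat n n" "Z \<in> carrier_mat n n" for Y Z
  proof -
    have "map_mat cnj (Y * Z) = map_mat cnj Y * map_mat cnj Z"
      using that by (auto intro!: eq_matI simp: scalar_prod_def)
    then show ?thesis
      using that unfolding K_def by (simp add: kronecker_mult[of _ n n _ n n _ n _ n])
  qed
  have W: "word_prod n X w \<in> carrier_mat n n" if "w \<in> multi_indices d k" for w k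
    using word_prod_carrier[OF X] that by (auto simp: multi_indices_def)
  have Xi: "X i \<in> carrier_mat n n" if "i \<in> {1..d}" for i
    using X that by blast
  define T where "T = finsum_mat (n * n) (\<lambda>i. K (X i)) {1..d}"
  have T: "T = mat (n * n) (n * n) (\<lambda>p. \<Sum>i\<in>{1..d}. K (X i) $$ p)"
    unfolding T_def using K[OF Xi] by (intro finsum_mat_entrywise) auto
  have Tk: "T ^\<^sub>m k \<in> carrier_mat (n * n) (n * n)" for k
    by (rule pow_carrier_mat) (simp add: T)
  have "(T ^\<^sub>m k) $$ (p, q) = (\<Sum>w\<in>multi_indices d k. K (word_prod n X w) $$ (p, q))"
    if "p < n * n" "q < n * n" for p q
    using that
  proof (induction k arbitrary: p q)
    case 0
    have "K (1\<^sub>m n) = 1\<^sub>m (n * n)"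
    proof (rule eq_matI)
      fix i j assume ij: "i < dim_row (1\<^sub>m (n * n))" "j < dim_col (1\<^sub>m (n * n))"
      then have "i div n < n" "i mod n < n" "j div n < n" "j mod n < n"
        by (auto simp: div_mod_less)
      moreover have "i = j \<longleftrightarrow> i div n = j div n \<and> i mod n = j mod n"
        by (metis div_mult_mod_eq)
      ultimately show "K (1\<^sub>m n) $$ (i, j) = 1\<^sub>m (n * n) $$ (i, j)"
        using ij unfolding K_def by (subst index_kronecker[of _ n n _ n n]) auto
    qed (auto simp: K_def kronecker_def)
    moreover have "multi_indices d 0 = {[]}"
      by (auto simp: multi_indices_def)
    ultimately show ?case
      using 0 by (simp add: word_prod_def T)
  next
    case (Suc k)
    have "(T ^\<^sub>m Suc k) $$ (p, q) = (\<Sum>l<n * n. (T ^\<^sub>m k) $$ (p, l) * T $$ (l, q))"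
      using Suc.prems Tk[of k] Tk[of 1] by (auto simp: scalar_prod_def lessThan_atLeast0 intro!: sum.cong)
    also have "\<dots> = (\<Sum>l<n * n. \<Sum>w\<in>multi_indices d k. \<Sum>i\<in>{1..d}.
        K (word_prod n X w) $$ (p, l) * K (X i) $$ (l, q))"
      using Suc by (intro sum.cong) (auto simp: T sum_product)
    also have "\<dots> = (\<Sum>w\<in>multi_indices d k. \<Sum>i\<in>{1..d}. \<Sum>l<n * n.
        K (word_prod n X w) $$ (p, l) * K (X i) $$ (l, q))"
      by (subst sum.swap, subst (2) sum.swap) simp
    also have "\<dots> = (\<Sum>w\<in>multi_indices d k. \<Sum>i\<in>{1..d}. K (word_prod n X (w @ [i])) $$ (p, q))"
    \<comment> \<open>With the sum over \<open>l\<close> innermost, it is an entry of the product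
      \<open>K (word_prod n X w) * K (X i)\<close>, which multiplicativity turns into
      \<open>K\<close> of the longer word.\<close>
    proof (intro sum.cong refl)
      fix w i assume w: "w \<in> multi_indices d k" and i: "i \<in> {1..d}"
      have "K (word_prod n X (w @ [i])) = K (word_prod n X w) * K (X i)"
        using word_prod_snoc[OF X _ i, of w] w K_mult[OF W[OF w] Xi[OF i]]
        by (auto simp: multi_indices_def)
      then show "(\<Sum>l<n * n. K (word_prod n X w) $$ (p, l) * K (X i) $$ (l, q)) =
          K (word_prod n X (w @ [i])) $$ (p, q)"
        using Suc.prems K[OF W[OF w]] K[OF Xi[OF i]]
        by (auto simp: scalar_prod_def lessThan_atLeast0 intro!: sum.cong)
    qed
    finally show ?case
      by (simp only: sum_multi_indices_Suc)
  qed
  moreover have "p div n < n" "p mod n < n" "q div n < n" "q mod n < n"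
    using pq by (auto simp: div_mod_less)
  then have "K (word_prod n X w) $$ (p, q) =
      cnj (word_prod n X w $$ (p div n, q div n)) * word_prod n X w $$ (p mod n, q mod n)"
    if "w \<in> multi_indices d k" for w
    unfolding K_def using W[OF that] pq by (subst index_kronecker[of _ n n _ n n]) auto
  ultimately show ?thesis
    using pq by (simp add: T_def K_def)
qed

section \<open>Cauchy-Schwarz and the operator norm against matrix entries\<close>

lemma cmod_sum_mult_le:
  "cmod (\<Sum>i\<in>I. f i * g i) \<le> L2_set (\<lambda>i. cmod (f i)) I * L2_set (\<lambda>i. cmod (g i)) I"
proof -
  have "cmod (\<Sum>i\<in>I. f i * g i) \<le> (\<Sum>i\<in>I. \<bar>cmod (f i)\<bar> * \<bar>cmod (g i)\<bar>)"
    by (rule order_trans[OF norm_sum]) (simp add: norm_mult)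
  also have "\<dots> \<le> L2_set (\<lambda>i. cmod (f i)) I * L2_set (\<lambda>i. cmod (g i)) I"
    by (rule L2_set_mult_ineq)
  finally show ?thesis .
qed

lemma cmod_sum_mult_le_square:
  "(cmod (\<Sum>i\<in>I. f i * g i))\<^sup>2 \<le> (\<Sum>i\<in>I. (cmod (f i))\<^sup>2) * (\<Sum>i\<in>I. (cmod (g i))\<^sup>2)"
  using power_mono[OF cmod_sum_mult_le[of f g I], of 2]
  by (simp add: power_mult_distrib L2_set_def sum_nonneg)

text \<open>Cauchy-Schwarz in each row, summed over the rows, gives the Frobenius norm as a
  Lipschitz constant.\<close>

lemma vec_norm2_mult_mat_vec_le:
  assumes A: "A \<in> carrier_mat m n" and v: "v \<in> carrier_vec n"
  shows "vec_norm2 (A *\<^sub>v v) \<le> sqrt (\<Sum>i<m. \<Sum>j<n. (cmod (A $$ (i, j)))\<^sup>2) * vec_norm2 v"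
proof -
  have "(\<Sum>i<m. (cmod ((A *\<^sub>v v) $ i))\<^sup>2) \<le>
      (\<Sum>i<m. (\<Sum>j<n. (cmod (A $$ (i, j)))\<^sup>2) * (\<Sum>j<n. (cmod (v $ j))\<^sup>2))"
  proof (intro sum_mono)
    fix i assume "i \<in> {..<m}"
    then have "(A *\<^sub>v v) $ i = (\<Sum>j<n. A $$ (i, j) * v $ j)"
      using A v by (auto simp: scalar_prod_def lessThan_atLeast0 intro!: sum.cong)
    then show "(cmod ((A *\<^sub>v v) $ i))\<^sup>2 \<le> (\<Sum>j<n. (cmod (A $$ (i, j)))\<^sup>2) * (\<Sum>j<n. (cmod (v $ j))\<^sup>2)"
      using cmod_sum_mult_le_square by simp
  qed
  then have "sqrt (\<Sum>i<m. (cmod ((A *\<^sub>v v) $ i))\<^sup>2) \<le>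
      sqrt ((\<Sum>i<m. \<Sum>j<n. (cmod (A $$ (i, j)))\<^sup>2) * (\<Sum>j<n. (cmod (v $ j))\<^sup>2))"
    by (simp add: sum_distrib_right)
  then show ?thesis
    using A v by (simp add: vec_norm2_def L2_set_def real_sqrt_mult)
qed

lemma vec_norm2_unit_vec: "i < n \<Longrightarrow> vec_norm2 (unit_vec n i) = 1"
  by (simp add: vec_norm2_def L2_set_def unit_vec_def if_distrib[of cmod] if_distrib[of "\<lambda>x. x\<^sup>2"]
      sum.delta cong: if_cong)

lemma op_norm_le_frobenius:
  assumes A: "A \<in> carrier_mat m n" and n: "n > 0"
  shows "op_norm A \<le> sqrt (\<Sum>i<m. \<Sum>j<n. (cmod (A $$ (i, j)))\<^sup>2)"
  unfolding op_norm_def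
proof (rule cSUP_least)
  \<comment> \<open>With at least one column the unit sphere is nonempty; the supremum over an empty
    set would be unspecified.\<close>
  show "{v \<in> carrier_vec (dim_col A). vec_norm2 v = 1} \<noteq> {}"
    using vec_norm2_unit_vec[OF n] A by (metis (mono_tags, lifting) carrier_matD(2) empty_Collect_eq unit_vec_carrier)
next
  fix v assume "v \<in> {v \<in> carrier_vec (dim_col A). vec_norm2 v = 1}"
  then show "vec_norm2 (A *\<^sub>v v) \<le> sqrt (\<Sum>i<m. \<Sum>j<n. (cmod (A $$ (i, j)))\<^sup>2)"
    using vec_norm2_mult_mat_vec_le[OF A, of v] A by auto
qed

text \<open>Test the norm on the unit vector \<open>unit_vec n j\<close>, whose image is column
  \<open>j\<close>. The Frobenius bound makes the supremum a genuine one.\<close>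

lemma cmod_index_le_op_norm:
  assumes A: "A \<in> carrier_mat m n" and ij: "i < m" "j < n"
  shows "cmod (A $$ (i, j)) \<le> op_norm A"
proof -
  have "cmod (A $$ (i, j)) = cmod ((A *\<^sub>v unit_vec n j) $ i)"
    using A ij by simp
  also have "\<dots> \<le> vec_norm2 (A *\<^sub>v unit_vec n j)"
    unfolding vec_norm2_def using A ij
    by (intro member_le_L2_set[of _ _ "\<lambda>i. cmod ((A *\<^sub>v unit_vec n j) $ i)"]) auto
  also have "\<dots> \<le> op_norm A"
    unfolding op_norm_def
  proof (rule cSUP_upper)
    show "bdd_above ((\<lambda>v. vec_norm2 (A *\<^sub>v v)) ` {v \<in> carrier_vec (dim_col A). vec_norm2 v = 1})"
      using vec_norm2_mult_mat_vec_le[OF A] A by (fastforce intro!: bdd_aboveI2)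
  qed (use A ij vec_norm2_unit_vec in auto)
  finally show ?thesis .
qed

section \<open>Entry energies and the supremum over unit families\<close>

text \<open>This is the squared norm of the linear functional on square-summable families that sends
  \<open>a\<close> to the \<open>(i, j)\<close> entry of the combination of the word products with
  coefficients \<open>a\<close>.\<close>

definition entry_energy :: "nat \<Rightarrow> nat \<Rightarrow> (nat \<Rightarrow> complex mat) \<Rightarrow> nat \<Rightarrow> nat \<Rightarrow> nat \<Rightarrow> real" where
  "entry_energy n d X k i j = (\<Sum>w\<in>multi_indices d k. (cmod (word_prod n X w $$ (i, j)))\<^sup>2)"

lemma entry_energy_nonneg: "0 \<le> entry_energy n d X k i j"
  unfolding entry_energy_def by (rule sum_nonneg) simp

definition family_sum :: "nat \<Rightarrow> nat \<Rightarrow> (nat \<Rightarrow> complex mat) \<Rightarrow> nat \<Rightarrow> (nat list \<Rightarrow> complex) \<Rightarrow> complex mat" where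
  "family_sum n d X k a = finsum_mat n (\<lambda>w. a w \<cdot>\<^sub>m word_prod n X w) (multi_indices d k)"

context
  fixes n d :: nat and X :: "nat \<Rightarrow> complex mat"
  assumes n: "n \<ge> 1" and d: "d \<ge> 1"
    and X: "\<And>i. i \<in> {1..d} \<Longrightarrow> X i \<in> carrier_mat n n"
begin

lemma X_carrier: "X ` {1..d} \<subseteq> carrier_mat n n"
  using X by auto

lemma word_carrier: "w \<in> multi_indices d k \<Longrightarrow> word_prod n X w \<in> carrier_mat n n"
  using word_prod_carrier[OF X_carrier] by (auto simp: multi_indices_def)

lemma family_sum_entrywise:
  "family_sum n d X k a = mat n n (\<lambda>p. \<Sum>w\<in>multi_indices d k. a w * word_prod n X w $$ p)"
proof -
  have "family_sum n d X k a = mat n n (\<lambda>p. \<Sum>w\<in>multi_indices d k. (a w \<cdot>\<^sub>m word_prod n X w) $$ p)"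
    unfolding family_sum_def using word_carrier by (intro finsum_mat_entrywise) auto
  also have "\<dots> = mat n n (\<lambda>p. \<Sum>w\<in>multi_indices d k. a w * word_prod n X w $$ p)"
    by (intro cong_mat refl sum.cong) (auto dest!: word_carrier)
  finally show ?thesis .
qed

lemma family_sum_carrier [simp]: "family_sum n d X k a \<in> carrier_mat n n"
  by (simp add: family_sum_entrywise)

text \<open>Cauchy-Schwarz over words bounds each entry, the family contributing the factor 1; the
  Frobenius norm collects the entries. The bound does not depend on \<open>a\<close>.\<close>

lemma op_norm_family_sum_le:
  assumes a: "a \<in> unit_families d k"
  shows "op_norm (family_sum n d X k a) \<le> sqrt (\<Sum>i<n. \<Sum>j<n. entry_energy n d X k i j)"
proof (rule order_trans[OF op_norm_le_frobenius[OF family_sum_carrier]])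
  have "(cmod (family_sum n d X k a $$ (i, j)))\<^sup>2 \<le> entry_energy n d X k i j" if "i < n" "j < n" for i j
    using that a cmod_sum_mult_le_square[of a "\<lambda>w. word_prod n X w $$ (i, j)" "multi_indices d k"]
    by (simp add: family_sum_entrywise entry_energy_def unit_families_def)
  then show "sqrt (\<Sum>i<n. \<Sum>j<n. (cmod (family_sum n d X k a $$ (i, j)))\<^sup>2) \<le>
      sqrt (\<Sum>i<n. \<Sum>j<n. entry_energy n d X k i j)"
    by (intro real_sqrt_le_mono sum_mono) auto
qed (use n in simp)

lemma ex_unit_family: "unit_families d k \<noteq> {}"
proof -
  \<comment> \<open>The letter 1 is available because \<open>d \<ge> 1\<close>; for
    \<open>k = 0\<close> this is the empty word.\<close>
  let ?w = "replicate k 1"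
  have w: "?w \<in> multi_indices d k"
    using d by (auto simp: multi_indices_def)
  have "(\<Sum>w\<in>multi_indices d k. (cmod (if w = ?w then 1 else 0))\<^sup>2) = 1"
    using w by (simp add: if_distrib[of cmod] if_distrib[of "\<lambda>x. x\<^sup>2"] sum.delta cong: if_cong)
  then have "(\<lambda>w. if w = ?w then 1 else 0) \<in> unit_families d k"
    by (simp add: unit_families_def)
  then show ?thesis
    by blast
qed

lemma ex_family_entry_energy_le:
  assumes ij: "i < n" "j < n"
  shows "\<exists>a\<in>unit_families d k. sqrt (entry_energy n d X k i j) \<le> op_norm (family_sum n d X k a)"
proof (cases "entry_energy n d X k i j = 0")
  case True
  \<comment> \<open>Normalising by \<open>s\<close> would divide by zero here, but the left side is
    0, so any unit family serves.\<close>
  obtain a where a: "a \<in> unit_families d k"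
    using ex_unit_family by blast
  have "0 \<le> cmod (family_sum n d X k a $$ (i, j))"
    by simp
  also have "\<dots> \<le> op_norm (family_sum n d X k a)"
    by (rule cmod_index_le_op_norm[OF family_sum_carrier ij])
  finally show ?thesis
    using True a by auto
next
  case False
  define s where "s = sqrt (entry_energy n d X k i j)"
  have s: "s > 0" "s\<^sup>2 = entry_energy n d X k i j"
    using False entry_energy_nonneg[of n d X k i j] unfolding s_def by auto
  \<comment> \<open>the equality case of Cauchy--Schwarz\<close>
  define a where "a w = cnj (word_prod n X w $$ (i, j)) / of_real s" for w
  have "(\<Sum>w\<in>multi_indices d k. (cmod (a w))\<^sup>2) = entry_energy n d X k i j / s\<^sup>2"
    by (simp add: a_def norm_divide power_divide entry_energy_def sum_divide_distrib)
  then have a: "a \<in> unit_families d k"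
    using s False by (simp add: unit_families_def)
  have "family_sum n d X k a $$ (i, j) =
      (\<Sum>w\<in>multi_indices d k. of_real ((cmod (word_prod n X w $$ (i, j)))\<^sup>2 / s))"
    using ij by (auto simp: family_sum_entrywise a_def complex_norm_square mult.commute
        simp del: of_real_power intro!: sum.cong)
  also have "\<dots> = of_real (entry_energy n d X k i j / s)"
    by (simp add: entry_energy_def sum_divide_distrib)
  also have "entry_energy n d X k i j / s = s"
    using s by (simp add: power2_eq_square flip: s(2))
  finally have "s = cmod (family_sum n d X k a $$ (i, j))"
    using s by simp
  also have "\<dots> \<le> op_norm (family_sum n d X k a)"
    by (rule cmod_index_le_op_norm[OF family_sum_carrier ij])
  finally show ?thesis
    using a unfolding s_def by blast
qed

section \<open>Energies against the spectral radius\<close>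

abbreviation (input) kron_sum :: "complex mat" where
  "kron_sum \<equiv> finsum_mat (n * n) (\<lambda>i. kronecker (map_mat cnj (X i)) (X i)) {1..d}"

lemma kron_sum_carrier: "kron_sum \<in> carrier_mat (n * n) (n * n)"
proof -
  have "kronecker (map_mat cnj (X i)) (X i) \<in> carrier_mat (n * n) (n * n)" if "i \<in> {1..d}" for i
    using X[OF that] by auto
  then show ?thesis
    by (subst finsum_mat_entrywise) auto
qed

text \<open>The index \<open>i * n + i\<close> encodes the pair \<open>(i, i)\<close>, so both
  Kronecker factors contribute the same entry, once conjugated, and their product is its squared
  modulus.\<close>

lemma entry_energy_eq:
  assumes ij: "i < n" "j < n"
  shows "complex_of_real (entry_energy n d X k i j) = (kron_sum ^\<^sub>m k) $$ (i * n + i, j * n + j)"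
  using mult_add_less_mult[OF ij(1) ij(1)] mult_add_less_mult[OF ij(2) ij(2)] ij
  by (subst kronecker_sum_pow_mat[OF X_carrier])
    (auto simp: entry_energy_def complex_norm_square mult.commute simp del: of_real_power intro!: sum.cong)

text \<open>A general entry of the power is an inner product of two vectors indexed by words whose
  squared norms are energies, so Cauchy-Schwarz bounds its square by a product of two
  energies.\<close>

lemma norm_bound_kronecker_sum_pow:
  assumes b: "\<And>i j. i < n \<Longrightarrow> j < n \<Longrightarrow> entry_energy n d X k i j \<le> b"
  shows "norm_bound (kron_sum ^\<^sub>m k) b"
proof
  fix p q assume "p < dim_row (kron_sum ^\<^sub>m k)" "q < dim_col (kron_sum ^\<^sub>m k)"
  then have pq: "p < n * n" "q < n * n"
    using pow_carrier_mat[OF kron_sum_carrier, of k] by auto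
  then have dm: "p div n < n" "p mod n < n" "q div n < n" "q mod n < n"
    by (auto simp: div_mod_less)
  have b0: "0 \<le> b"
    using b[OF dm(1,3)] entry_energy_nonneg[of n d X k "p div n" "q div n"] by linarith
  have "(cmod ((kron_sum ^\<^sub>m k) $$ (p, q)))\<^sup>2 \<le>
      entry_energy n d X k (p div n) (q div n) * entry_energy n d X k (p mod n) (q mod n)"
    using cmod_sum_mult_le_square[of "\<lambda>w. cnj (word_prod n X w $$ (p div n, q div n))"
        "\<lambda>w. word_prod n X w $$ (p mod n, q mod n)" "multi_indices d k"]
    unfolding kronecker_sum_pow_mat[OF X_carrier pq] entry_energy_def by simp
  also have "\<dots> \<le> b\<^sup>2"
    unfolding power2_eq_square using b dm b0 by (intro mult_mono) (auto simp: entry_energy_nonneg)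
  finally show "norm ((kron_sum ^\<^sub>m k) $$ (p, q)) \<le> b"
    using b0 by (rule power2_le_imp_le)
qed

lemma ex_family_spectral_radius_le:
  "\<exists>a\<in>unit_families d k. 1 / n * sqrt (spectral_radius kron_sum) ^ k \<le> op_norm (family_sum n d X k a)"
proof -
  obtain p where p: "p \<in> {..<n} \<times> {..<n}"
    "\<And>q. q \<in> {..<n} \<times> {..<n} \<Longrightarrow> case_prod (entry_energy n d X k) q \<le> case_prod (entry_energy n d X k) p"
    using ex_max_on_finite[of "{..<n} \<times> {..<n}" "case_prod (entry_energy n d X k)"] n
    by (auto simp: lessThan_empty_iff)
  obtain i j where [simp]: "p = (i, j)"
    by (cases p)
  have ij: "i < n" "j < n"
    using p(1) by auto
  \<comment> \<open>The largest energy bounds every entry of the power. The factor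
    \<open>n * n\<close> is the size of \<open>kron_sum\<close>; its square root yields the constant
    \<open>1 / n\<close>.\<close>
  have "spectral_radius kron_sum ^ k \<le> real (n * n) * entry_energy n d X k i j"
    using n p(2) by (intro spectral_radius_power_le[OF kron_sum_carrier] norm_bound_kronecker_sum_pow) force+
  then have "sqrt (spectral_radius kron_sum ^ k) \<le> n * sqrt (entry_energy n d X k i j)"
    using real_sqrt_le_mono by (fastforce simp: real_sqrt_mult)
  then have "1 / n * sqrt (spectral_radius kron_sum) ^ k \<le> sqrt (entry_energy n d X k i j)"
    using n by (simp add: real_sqrt_power field_simps)
  then show ?thesis
    using ex_family_entry_energy_le[OF ij, of k] by force
qed

lemma op_norm_family_sum_exponential_bound:
  assumes r: "sqrt (spectral_radius kron_sum) < r"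
  shows "\<exists>c>0. \<forall>k. \<forall>a\<in>unit_families d k. op_norm (family_sum n d X k a) \<le> c * r ^ k"
proof -
  have sr: "0 \<le> spectral_radius kron_sum"
    using n by (intro spectral_radius_nonneg[OF kron_sum_carrier]) auto
  then have r0: "0 < r"
    using r real_sqrt_ge_zero[OF sr] by linarith
  \<comment> \<open>Energies are squared quantities, so they grow at most like powers of
    \<open>r\<^sup>2\<close>; the final square root restores \<open>r ^ k\<close>.\<close>
  have "spectral_radius kron_sum < r\<^sup>2"
    using r r0 sr by (metis less_eq_real_def real_less_lsqrt real_sqrt_less_iff real_sqrt_unique)
  then obtain c where c: "c > 0" "\<And>k. norm_bound (kron_sum ^\<^sub>m k) (c * (r\<^sup>2) ^ k)"
    using spectral_radius_pow_mat_bound[OF kron_sum_carrier, of "r\<^sup>2"] n by auto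
  \<comment> \<open>There are \<open>n * n\<close> energies, each at most
    \<open>c * (r\<^sup>2) ^ k\<close>; the root of their sum gives
    \<open>n * sqrt c\<close>.\<close>
  have "op_norm (family_sum n d X k a) \<le> (n * sqrt c) * r ^ k" if a: "a \<in> unit_families d k" for k a
  proof -
    have "entry_energy n d X k i j \<le> c * (r\<^sup>2) ^ k" if ij: "i < n" "j < n" for i j
    proof -
      have "entry_energy n d X k i j = cmod ((kron_sum ^\<^sub>m k) $$ (i * n + i, j * n + j))"
        unfolding entry_energy_eq[OF ij, symmetric] by (simp add: entry_energy_nonneg)
      also have "\<dots> \<le> c * (r\<^sup>2) ^ k"
        by (rule norm_bound_pow_matD[OF kron_sum_carrier c(2) mult_add_less_mult[OF ij(1) ij(1)]
              mult_add_less_mult[OF ij(2) ij(2)]])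
      finally show ?thesis .
    qed
    then have "(\<Sum>i<n. \<Sum>j<n. entry_energy n d X k i j) \<le> (\<Sum>i<n. \<Sum>j<n. c * (r\<^sup>2) ^ k)"
      by (intro sum_mono) auto
    also have "\<dots> = (n * sqrt c * r ^ k)\<^sup>2"
      using c(1) by (simp add: power_mult_distrib power2_eq_square flip: power_mult)
    finally have "sqrt (\<Sum>i<n. \<Sum>j<n. entry_energy n d X k i j) \<le> n * sqrt c * r ^ k"
      using c(1) r0 by (intro real_le_lsqrt) (auto intro!: sum_nonneg simp: entry_energy_nonneg)
    then show ?thesis
      using op_norm_family_sum_le[OF a] by linarith
  qed
  then show ?thesis
    using c(1) n by (intro exI[of _ "n * sqrt c"]) auto
qed

section \<open>Passage to the limit\<close>

lemma SUP_root_op_norm_tendsto: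
  "(\<lambda>k. SUP a \<in> unit_families d k. root k (op_norm (family_sum n d X k a)))
     \<longlonglongrightarrow> outer_spectral_radius n d X"
  unfolding outer_spectral_radius_def
proof (rule root_squeeze_tendsto)
  show "0 \<le> sqrt (spectral_radius kron_sum)"
    using n by (intro real_sqrt_ge_zero spectral_radius_nonneg[OF kron_sum_carrier]) auto
  show "0 < 1 / real n"
    using n by simp
next
  fix k :: nat assume k: "k \<ge> 1"
  obtain a where a: "a \<in> unit_families d k"
    "1 / n * sqrt (spectral_radius kron_sum) ^ k \<le> op_norm (family_sum n d X k a)"
    using ex_family_spectral_radius_le by blast
  \<comment> \<open>At fixed \<open>k\<close> the energy bound is uniform in the family, so the
    supremum is over a bounded set and dominates the value at the chosen \<open>a\<close>.\<close>
  obtain c where "\<And>a. a \<in> unit_families d k \<Longrightarrow> op_norm (family_sum n d X k a) \<le> c"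
    using op_norm_family_sum_le by blast
  then have "bdd_above ((\<lambda>a. root k (op_norm (family_sum n d X k a))) ` unit_families d k)"
    using k by (intro bdd_aboveI2[of _ _ "root k c"]) simp
  then have "root k (op_norm (family_sum n d X k a)) \<le>
      (SUP a \<in> unit_families d k. root k (op_norm (family_sum n d X k a)))"
    by (rule cSUP_upper[OF a(1)])
  moreover have "root k (1 / n * sqrt (spectral_radius kron_sum) ^ k) \<le> root k (op_norm (family_sum n d X k a))"
    using a(2) k by simp
  ultimately show "root k (1 / n * sqrt (spectral_radius kron_sum) ^ k) \<le>
      (SUP a \<in> unit_families d k. root k (op_norm (family_sum n d X k a)))"
    by linarith
next
  fix r assume "sqrt (spectral_radius kron_sum) < r"
  then obtain c where c: "c > 0"
    "\<And>k a. a \<in> unit_families d k \<Longrightarrow> op_norm (family_sum n d X k a) \<le> c * r ^ k"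
    using op_norm_family_sum_exponential_bound by blast
  have "(SUP a \<in> unit_families d k. root k (op_norm (family_sum n d X k a))) \<le> root k (c * r ^ k)"
    if "k \<ge> 1" for k
    using c(2) that by (intro cSUP_least[OF ex_unit_family]) auto
  then show "\<exists>c>0. \<forall>k\<ge>1. (SUP a \<in> unit_families d k. root k (op_norm (family_sum n d X k a))) \<le> root k (c * r ^ k)"
    using c(1) by blast
qed

end

theorem theorem1p1:
  fixes n d :: nat and X :: "nat \<Rightarrow> complex mat"
  assumes "n \<ge> 1" and "d \<ge> 1"
    and "\<And>i. i \<in> {1..d} \<Longrightarrow> X i \<in> carrier_mat n n"
  shows "(\<lambda>k. SUP a \<in> unit_families d k.
            root k (op_norm (finsum_mat n (\<lambda>is. a is \<cdot>\<^sub>m word_prod n X is) (multi_indices d k))))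
         \<longlonglongrightarrow> outer_spectral_radius n d X"
  using SUP_root_op_norm_tendsto[OF assms] unfolding family_sum_def .

end
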